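(* Let $k\geq2$ be an integer, and let $G$ be a graph of order $n$ with $n\geq6k-4$. If $bind(G)>\frac{(3k-1)(n-1)}{kn-2k}$, then $G$ is fractional ID-$k$-factor-critical covered.
   Context: All graphs are finite and simple, with vertex set $V(G)$ and edge set $E(G)$; the order of $G$ is $|V(G)|$. For $x\in V(G)$, $N_G(x)$ is the set of vertices adjacent to $x$ in $G$, and for $X\subseteq V(G)$, $N_G(X)=\bigcup_{x\in X}N_G(x)$. The binding number of $G$ is $$bind(G)=\min\left\{\frac{|N_G(X)|}{|X|}:\emptyset\neq X\subseteq V(G),\ N_G(X)\neq V(G)\right\}.$$ A set $I\subseteq V(G)$ is independent if the induced subgraph $G[I]$ has no edges; $G-I=G[V(G)\setminus I]$. For a positive integer $k$, a fractional $k$-factor (that is, a fractional $[k,k]$-factor) of a graph $G$ with indicator function $h$ is given by a function $h:E(G)\rightarrow[0,1]$ such that $\sum_{e\ni x}h(e)=k$ for every $x\in V(G)$ (the sum is over edges $e$ incident with $x$); the fractional factor is the subgraph $G[F_h]$, where $F_h=\{e\in E(G):h(e)>0\}$. A graph $G$ is fractional $[k,k]$-covered if for every edge $e\in E(G)$, $G$ admits a fractional $k$-factor with indicator function $h$ (which may depend on $e$) satisfying $h(e)=1$. A graph $G$ is fractional ID-$k$-factor-critical covered (that is, fractional ID-$[k,k]$-factor-critical covered) if $G-I$ is fractional $[k,k]$-covered for every independent set $I$ of $G$. *)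

theory Defs
  imports Complex_Main
begin

text \<open>A graph is a pair of a vertex set and a set of edges, each edge being a two-element
  set of vertices.\<close>

definition simple_graph :: "'a set \<Rightarrow> 'a set set \<Rightarrow> bool" where
  "simple_graph V E \<longleftrightarrow> finite V \<and> (\<forall>e\<in>E. e \<subseteq> V \<and> card e = 2)"

definition neighbours :: "'a set set \<Rightarrow> 'a \<Rightarrow> 'a set" where
  "neighbours E x = {y. {x, y} \<in> E}"

definition neighbours_set :: "'a set set \<Rightarrow> 'a set \<Rightarrow> 'a set" where
  "neighbours_set E X = (\<Union>x\<in>X. neighbours E x)"

text \<open>For a nonempty finite simple graph the set below is finite and nonempty, since
  \<open>neighbours E x\<close> never contains \<open>x\<close>; so \<open>Min\<close> is the actual minimum. The value
  for the graph without vertices is unspecified.\<close>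

definition binding_number :: "'a set \<Rightarrow> 'a set set \<Rightarrow> real" where
  "binding_number V E = Min {real (card (neighbours_set E X)) / real (card X) | X.
     X \<noteq> {} \<and> X \<subseteq> V \<and> neighbours_set E X \<noteq> V}"

definition induced_edges :: "'a set set \<Rightarrow> 'a set \<Rightarrow> 'a set set" where
  "induced_edges E W = {e \<in> E. e \<subseteq> W}"

definition independent_set :: "'a set \<Rightarrow> 'a set set \<Rightarrow> 'a set \<Rightarrow> bool" where
  "independent_set V E I \<longleftrightarrow> I \<subseteq> V \<and> induced_edges E I = {}"

text \<open>The fractional \<open>k\<close>-factor itself is the subgraph formed by the edges \<open>e\<close> with
  \<open>h e > 0\<close>; it is determined by its indicator function \<open>h\<close>. Only the values of
  \<open>h\<close> on edges are relevant.\<close>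

definition fractional_factor_indicator ::
  "'a set \<Rightarrow> 'a set set \<Rightarrow> nat \<Rightarrow> ('a set \<Rightarrow> real) \<Rightarrow> bool" where
  "fractional_factor_indicator V E k h \<longleftrightarrow>
     (\<forall>e\<in>E. 0 \<le> h e \<and> h e \<le> 1) \<and>
     (\<forall>x\<in>V. (\<Sum>e\<in>{e \<in> E. x \<in> e}. h e) = real k)"

definition fractional_covered :: "'a set \<Rightarrow> 'a set set \<Rightarrow> nat \<Rightarrow> bool" where
  "fractional_covered V E k \<longleftrightarrow>
     (\<forall>e\<in>E. \<exists>h. fractional_factor_indicator V E k h \<and> h e = 1)"

definition fractional_ID_factor_critical_covered ::
  "'a set \<Rightarrow> 'a set set \<Rightarrow> nat \<Rightarrow> bool" where
  "fractional_ID_factor_critical_covered V E k \<longleftrightarrow>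
     (\<forall>I. independent_set V E I \<longrightarrow>
        fractional_covered (V - I) (induced_edges E (V - I)) k)"

end

theory Submission
  imports Defs
begin

text \<open>For an independent set \<open>I\<close> put \<open>H = G - I\<close>. By a cut criterion for fractional factors,
  \<open>H\<close> is fractional \<open>[k,k]\<close>-covered if
  \<open>k |T| + min 2 |S| \<le> k |S| + (\<Sum>x\<in>T. d(x))\<close> for all disjoint \<open>S\<close>, \<open>T\<close>, where \<open>d\<close> is the
  degree in \<open>H - S\<close>. Let \<open>h\<close> be the minimum of \<open>d\<close> on \<open>T\<close>. If \<open>h \<ge> k\<close>, this is clear. If
  \<open>1 \<le> h < k\<close>, it follows from the minimum degree bound that the binding number gives for the set
  of non-neighbours of a vertex. If \<open>h = 0\<close>, the set \<open>X = V(H - S)\<close> has no neighbour among the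
  vertices of \<open>T\<close> isolated in \<open>H - S\<close>, and the binding number condition is applied to
  this \<open>X\<close>.\<close>

section \<open>Bipartite degree realisation from a cut condition\<close>

text \<open>Every pair counted once on the left lies in at least one of the two sets on the right,
  and every pair counted twice lies in both.\<close>

lemma card_cut_submodular:
  assumes "finite D"
  shows "card {p \<in> D. fst p \<in> A \<union> A' \<and> snd p \<notin> B \<union> B'}
       + card {p \<in> D. fst p \<in> A \<inter> A' \<and> snd p \<notin> B \<inter> B'}
       \<le> card {p \<in> D. fst p \<in> A \<and> snd p \<notin> B} + card {p \<in> D. fst p \<in> A' \<and> snd p \<notin> B'}"
  (is "card ?U + card ?I \<le> card ?P + card ?Q")
proof -
  have "card ?U + card ?I = card (?U \<union> ?I) + card (?U \<inter> ?I)"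
    using assms by (intro card_Un_Int) auto
  also have "\<dots> \<le> card (?P \<union> ?Q) + card (?P \<inter> ?Q)"
    using assms by (intro add_mono card_mono) auto
  also have "\<dots> = card ?P + card ?Q"
    using assms by (intro card_Un_Int[symmetric]) auto
  finally show ?thesis .
qed

lemma card_filter_insert:
  assumes "finite D" "q \<notin> D"
  shows "int (card {p \<in> insert q D. P p}) = int (card {p \<in> D. P p}) + of_bool (P q)"
proof (cases "P q")
  case True
  then have "{p \<in> insert q D. P p} = insert q {p \<in> D. P p}" by auto
  then show ?thesis using assms True by simp
next
  case False
  then have "{p \<in> insert q D. P p} = {p \<in> D. P p}" by auto
  then show ?thesis using False by simp
qed

lemma sum_decrement:
  fixes r :: "'a \<Rightarrow> int"
  assumes "finite A"
  shows "sum (r(x := r x - 1)) A = sum r A - of_bool (x \<in> A)"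
proof -
  have "sum (r(x := r x - 1)) A = (\<Sum>a\<in>A. r a - (if x = a then 1 else 0))"
    by (intro sum.cong) auto
  then show ?thesis
    using assms by (simp add: sum_subtractf)
qed

text \<open>Edges are decided one at a time. If an edge can neither be discarded nor be used, then two
  tight cuts contradict submodularity, the edge itself making the inequality strict.\<close>

lemma bipartite_degree_realisation:
  fixes r :: "'a \<Rightarrow> int" and c :: "'b \<Rightarrow> int"
  assumes "finite X" "finite Y" "D \<subseteq> X \<times> Y" "sum r X = sum c Y"
    and "\<And>A B. A \<subseteq> X \<Longrightarrow> B \<subseteq> Y \<Longrightarrow>
      sum r A \<le> sum c B + int (card {p \<in> D. fst p \<in> A \<and> snd p \<notin> B})"
  shows "\<exists>F\<subseteq>D. (\<forall>x\<in>X. int (card {p \<in> F. fst p = x}) = r x) \<and>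
                (\<forall>y\<in>Y. int (card {p \<in> F. snd p = y}) = c y)"
proof -
  have "finite D" using assms(1-3) finite_subset by blast
  then show ?thesis using assms(3-5)
  proof (induction D arbitrary: r c rule: finite_induct)
    case empty
    have cut: "sum r A \<le> sum c B" if "A \<subseteq> X" "B \<subseteq> Y" for A B
      using empty(3)[OF that] by simp
    \<comment> \<open>The first cut gives \<open>r x \<le> 0\<close>. The second gives
      \<open>r x \<ge> 0\<close>, because the total sums of \<open>r\<close> and \<open>c\<close>
      agree.\<close>
    have "r x = 0" if "x \<in> X" for x
      using cut[of "{x}" "{}"] cut[of "X - {x}" Y] that assms(1) empty(2)
      by (simp add: sum_diff1)
    moreover have "c y = 0" if "y \<in> Y" for y
      using cut[of "{}" "{y}"] cut[of X "Y - {y}"] that assms(2) empty(2)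
      by (simp add: sum_diff1)
    ultimately show ?case by auto
  next
    case (insert q D)
    obtain x y where q: "q = (x, y)" by fastforce
    then have xy: "x \<in> X" "y \<in> Y" using insert.prems(1) by auto
    let ?cut = "\<lambda>A B. int (card {p \<in> D. fst p \<in> A \<and> snd p \<notin> B})"
    have ins: "int (card {p \<in> insert q D. P p}) = int (card {p \<in> D. P p}) + of_bool (P q)" for P
      using card_filter_insert[OF insert(1,2)] .
    have cut: "sum r A \<le> sum c B + ?cut A B + of_bool (x \<in> A \<and> y \<notin> B)"
      if "A \<subseteq> X" "B \<subseteq> Y" for A B
      using insert.prems(3)[OF that] unfolding ins by (simp add: q)
    have fin: "finite A" "finite B" if "A \<subseteq> X" "B \<subseteq> Y" for A B
      using that assms(1,2) finite_subset by blast+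
    let ?r = "r(x := r x - 1)" and ?c = "c(y := c y - 1)"
    consider
        (discard) "\<forall>A B. A \<subseteq> X \<longrightarrow> B \<subseteq> Y \<longrightarrow> sum r A \<le> sum c B + ?cut A B"
      | (use) "\<forall>A B. A \<subseteq> X \<longrightarrow> B \<subseteq> Y \<longrightarrow> sum ?r A \<le> sum ?c B + ?cut A B"
      | (tight) A B A' B' where "A \<subseteq> X" "B \<subseteq> Y" "sum r A > sum c B + ?cut A B"
          "A' \<subseteq> X" "B' \<subseteq> Y" "sum ?r A' > sum ?c B' + ?cut A' B'"
      by (meson not_le)
    then show ?case
    proof cases
      case discard
      then obtain F where "F \<subseteq> D" "\<forall>x\<in>X. int (card {p \<in> F. fst p = x}) = r x"
          "\<forall>y\<in>Y. int (card {p \<in> F. snd p = y}) = c y"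
        using insert.IH[of r c] insert.prems by blast
      then show ?thesis by blast
    next
      case use
      have "sum ?r X = sum ?c Y"
        unfolding sum_decrement[OF assms(1)] sum_decrement[OF assms(2)]
        using insert.prems(2) xy by simp
      then obtain F where F: "F \<subseteq> D" "\<forall>x\<in>X. int (card {p \<in> F. fst p = x}) = ?r x"
          "\<forall>y\<in>Y. int (card {p \<in> F. snd p = y}) = ?c y"
        using insert.IH[of ?r ?c] insert.prems(1) use by blast
      have F_ins: "int (card {p \<in> insert q F. P p}) = int (card {p \<in> F. P p}) + of_bool (P q)" for P
        using F(1) insert(1,2) by (intro card_filter_insert) (auto intro: finite_subset)
      have "insert q F \<subseteq> insert q D" using F(1) by blast
      moreover have "\<forall>x\<in>X. int (card {p \<in> insert q F. fst p = x}) = r x"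
        unfolding F_ins using F(2) by (auto simp: q)
      moreover have "\<forall>y\<in>Y. int (card {p \<in> insert q F. snd p = y}) = c y"
        unfolding F_ins using F(3) by (auto simp: q)
      ultimately show ?thesis by blast
    next
      case tight
      note f = fin[OF tight(1,2)] fin[OF tight(4,5)]
      \<comment> \<open>Comparing each failed inequality with \<open>cut\<close> forces the position
        of \<open>q\<close>: it crosses the first cut, and in the second \<open>x\<close> lies
        outside \<open>A'\<close> while \<open>y\<close> lies in \<open>B'\<close>.\<close>
      have 1: "x \<in> A" "y \<notin> B" "sum r A \<ge> sum c B + ?cut A B + 1"
        using cut[OF tight(1,2)] tight(3) by (auto split: if_splits simp: of_bool_def)
      have 2: "x \<notin> A'" "y \<in> B'" "sum r A' \<ge> sum c B' + ?cut A' B'"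
        using cut[OF tight(4,5)] tight(6)
        unfolding sum_decrement[OF f(3)] sum_decrement[OF f(4)]
        by (auto split: if_splits simp: of_bool_def)
      \<comment> \<open>As \<open>y \<in> B'\<close> and \<open>x \<notin> A'\<close>,
        \<open>q\<close> crosses neither the union cut nor the intersection cut, so both hold
        without the extra 1. Added up, they contradict submodularity by the 1 in fact
        \<open>1\<close>.\<close>
      have "sum r (A \<union> A') \<le> sum c (B \<union> B') + ?cut (A \<union> A') (B \<union> B')"
        using cut[of "A \<union> A'" "B \<union> B'"] tight(1,2,4,5) 2 by simp
      moreover have "sum r (A \<inter> A') \<le> sum c (B \<inter> B') + ?cut (A \<inter> A') (B \<inter> B')"
        using cut[of "A \<inter> A'" "B \<inter> B'"] tight(1,2,4,5) 2 by auto
      moreover have "sum r (A \<union> A') + sum r (A \<inter> A') = sum r A + sum r A'"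
        using f by (simp add: sum.union_inter)
      moreover have "sum c (B \<union> B') + sum c (B \<inter> B') = sum c B + sum c B'"
        using f by (simp add: sum.union_inter)
      moreover have "?cut (A \<union> A') (B \<union> B') + ?cut (A \<inter> A') (B \<inter> B') \<le> ?cut A B + ?cut A' B'"
        using card_cut_submodular[OF insert(1), of A A' B B'] by linarith
      ultimately show ?thesis using 1(3) 2(3) by linarith
    qed
  qed
qed

section \<open>Cut criteria for fractional factors and covered graphs\<close>

text \<open>The bipartite double cover: a half-integral factor is the average of the two orientations of
  each edge. Cuts \<open>(A, B)\<close> of the double cover with overlapping sides reduce to the disjoint
  pair \<open>S = B - A\<close>, \<open>T = A - B\<close>.\<close>

lemma fractional_f_factor:
  fixes f :: "'a \<Rightarrow> int"
  assumes G: "simple_graph V E"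
    and cut: "\<And>S T. S \<subseteq> V \<Longrightarrow> T \<subseteq> V \<Longrightarrow> S \<inter> T = {} \<Longrightarrow>
      sum f T \<le> sum f S + int (card {(x, y). x \<in> T \<and> y \<in> V - S \<and> {x, y} \<in> E})"
  shows "\<exists>h. (\<forall>e\<in>E. 0 \<le> h e \<and> h e \<le> (1::real)) \<and>
             (\<forall>x\<in>V. (\<Sum>e\<in>{e \<in> E. x \<in> e}. h e) = real_of_int (f x))"
proof -
  have finV: "finite V" and E: "\<And>e. e \<in> E \<Longrightarrow> e \<subseteq> V \<and> card e = 2"
    using G by (auto simp: simple_graph_def)
  have finE: "finite E" using finV E by (auto intro!: finite_subset[of E "Pow V"])
  define D where "D = {(x, y). {x, y} \<in> E}"
  have D: "D \<subseteq> V \<times> V" using E by (auto simp: D_def)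
  have finD: "finite D" using D finV by (meson finite_SigmaI finite_subset)
  have D_irrefl: "x \<noteq> y" if "(x, y) \<in> D" for x y
    using that E[of "{x, y}"] by (auto simp: D_def)
  have "sum f A \<le> sum f B + int (card {p \<in> D. fst p \<in> A \<and> snd p \<notin> B})"
    if A: "A \<subseteq> V" and B: "B \<subseteq> V" for A B
  proof -
    let ?T = "A - B" and ?S = "B - A"
    let ?C = "{p \<in> D. fst p \<in> A \<and> snd p \<notin> B}"
    let ?C' = "{(x, y). x \<in> ?T \<and> y \<in> V - ?S \<and> {x, y} \<in> E}"
    have "card ?C' \<le> card ?C"
      \<comment> \<open>reverse the pairs from \<open>T\<close> to \<open>A \<inter> B\<close>\<close>
    proof (rule card_inj_on_le)
      let ?g = "\<lambda>p. if snd p \<in> B then (snd p, fst p) else p"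
      show "inj_on ?g ?C'" by (auto simp: inj_on_def split: if_splits)
      show "?g ` ?C' \<subseteq> ?C" by (auto simp: D_def insert_commute)
      show "finite ?C" using finD by simp
    qed
    moreover have "sum f ?T \<le> sum f ?S + int (card ?C')"
      using A B by (intro cut) auto
    moreover have "sum f A = sum f ?T + sum f (A \<inter> B)" "sum f B = sum f ?S + sum f (A \<inter> B)"
      using A B finV
      by (metis add.commute finite_subset sum.Int_Diff,
          metis Int_commute add.commute finite_subset sum.Int_Diff)
    ultimately show ?thesis by linarith
  qed
  then obtain F where F: "F \<subseteq> D" "\<forall>x\<in>V. int (card {p \<in> F. fst p = x}) = f x"
      "\<forall>x\<in>V. int (card {p \<in> F. snd p = x}) = f x"
    using bipartite_degree_realisation[OF finV finV D, of f f] by blast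
  have finF: "finite F" using F(1) finD finite_subset by blast
  define S where "S e = {p \<in> F. {fst p, snd p} = e}" for e
  define h where "h e = real (card (S e)) / 2" for e
  have "h e \<le> 1" if "e \<in> E" for e
  proof -
    obtain u v where "e = {u, v}" using E \<open>e \<in> E\<close> unfolding card_2_iff by blast
    then have "S e \<subseteq> {(u, v), (v, u)}" by (auto simp: S_def doubleton_eq_iff)
    then have "card (S e) \<le> card {(u, v), (v, u)}" by (intro card_mono) auto
    also have "\<dots> \<le> 2" using card_length[of "[(u, v), (v, u)]"] by simp
    finally show ?thesis by (simp add: h_def)
  qed
  moreover have "(\<Sum>e\<in>{e \<in> E. x \<in> e}. h e) = real_of_int (f x)" if x: "x \<in> V" for x
  proof -
    \<comment> \<open>The pairs of \<open>F\<close> at \<open>x\<close> are those leaving and those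
      entering \<open>x\<close>, \<open>f x\<close> of each kind and disjoint as there are no loops.
      Halving the total gives \<open>f x\<close>.\<close>
    have "(\<Sum>e\<in>{e \<in> E. x \<in> e}. card (S e)) = card (\<Union>e\<in>{e \<in> E. x \<in> e}. S e)"
      using finE finF by (intro card_UN_disjoint[symmetric]) (auto simp: S_def)
    also have "(\<Union>e\<in>{e \<in> E. x \<in> e}. S e) = {p \<in> F. fst p = x} \<union> {p \<in> F. snd p = x}"
      using F(1) by (auto simp: S_def D_def)
    also have "card \<dots> = card {p \<in> F. fst p = x} + card {p \<in> F. snd p = x}"
      using finF F(1) D_irrefl by (intro card_Un_disjoint) fastforce+
    finally have "int (\<Sum>e\<in>{e \<in> E. x \<in> e}. card (S e)) = 2 * f x"
      using F(2,3) x by simp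
    then have "real_of_int (int (\<Sum>e\<in>{e \<in> E. x \<in> e}. card (S e))) = real_of_int (2 * f x)"
      by (rule arg_cong)
    then show ?thesis by (simp add: h_def flip: sum_divide_distrib)
  qed
  ultimately show ?thesis by (intro exI[of _ h]) (auto simp: h_def)
qed

text \<open>An edge \<open>e\<close> with weight 1 amounts to a factor of the graph without \<open>e\<close>
  whose demand is lowered by 1 at both ends of \<open>e\<close>.\<close>

lemma fractional_coveredI:
  assumes G: "simple_graph V E"
    and cut: "\<And>S T. S \<subseteq> V \<Longrightarrow> T \<subseteq> V \<Longrightarrow> S \<inter> T = {} \<Longrightarrow>
      k * card T + min 2 (card S) \<le> k * card S + card {(x, y). x \<in> T \<and> y \<in> V - S \<and> {x, y} \<in> E}"
  shows "fractional_covered V E k"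
  unfolding fractional_covered_def
proof
  fix e assume e: "e \<in> E"
  have finV: "finite V" and E: "\<And>e. e \<in> E \<Longrightarrow> e \<subseteq> V \<and> card e = 2"
    using G by (auto simp: simple_graph_def)
  have finE: "finite E" using finV E by (auto intro!: finite_subset[of E "Pow V"])
  have e2: "finite e" "card e = 2" using E[OF e] card.infinite by fastforce+
  define f where "f x = int k - of_bool (x \<in> e)" for x
  have sum_f: "sum f A = int (k * card A) - int (card (A \<inter> e))" if "A \<subseteq> V" for A
  proof -
    have "finite A" using that finV finite_subset by blast
    then show ?thesis by (simp add: f_def sum_subtractf Int_def)
  qed
  have "sum f T \<le> sum f S + int (card {(x, y). x \<in> T \<and> y \<in> V - S \<and> {x, y} \<in> E - {e}})"
    if S: "S \<subseteq> V" and T: "T \<subseteq> V" and disj: "S \<inter> T = {}" for S T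
  proof -
    let ?C = "{(x, y). x \<in> T \<and> y \<in> V - S \<and> {x, y} \<in> E}"
    let ?C1 = "{(x, y). x \<in> T \<and> y \<in> V - S \<and> {x, y} \<in> E - {e}}"
    let ?C2 = "{(x, y). x \<in> T \<and> y \<in> V - S \<and> {x, y} = e}"
    have "finite (V \<times> V)" using finV by simp
    then have fin: "finite ?C1" "finite ?C2"
      using T by (auto elim!: rev_finite_subset)
    have "?C = ?C1 \<union> ?C2" using e by auto
    then have "card ?C \<le> card ?C1 + card ?C2" by (simp only: card_Un_le)
    \<comment> \<open>Removing \<open>e\<close> loses at most as many pairs as the demand on
      \<open>T\<close> drops. The drop on \<open>S\<close>, which works against the inequality, is
      paid for by the term \<open>min 2 (card S)\<close>.\<close>
    moreover have "card ?C2 \<le> card (T \<inter> e)"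
    proof (rule card_inj_on_le)
      show "inj_on fst ?C2" by (rule inj_onI) (clarsimp, metis doubleton_eq_iff)
      show "fst ` ?C2 \<subseteq> T \<inter> e" by auto
      show "finite (T \<inter> e)" using e2 by simp
    qed
    moreover have "card (S \<inter> e) \<le> min 2 (card S)"
      using card_mono[of e "S \<inter> e"] card_mono[of S "S \<inter> e"] e2 finite_subset[OF S finV] by simp
    ultimately show ?thesis
      using cut[OF S T disj] sum_f[OF S] sum_f[OF T] by linarith
  qed
  moreover have "simple_graph V (E - {e})" using G by (auto simp: simple_graph_def)
  ultimately obtain h where h: "\<forall>d\<in>E - {e}. 0 \<le> h d \<and> h d \<le> (1::real)"
      "\<forall>x\<in>V. (\<Sum>d\<in>{d \<in> E - {e}. x \<in> d}. h d) = real_of_int (f x)"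
    using fractional_f_factor[of V "E - {e}" f] by blast
  let ?h = "h(e := 1)"
  have "(\<Sum>d\<in>{d \<in> E. x \<in> d}. ?h d) = real k" if x: "x \<in> V" for x
  proof -
    have rest: "(\<Sum>d\<in>{d \<in> E - {e}. x \<in> d}. ?h d) = real k - of_bool (x \<in> e)"
      using h(2) x by (simp add: f_def cong: sum.cong_simp)
    show ?thesis
    proof (cases "x \<in> e")
      case True
      then have "{d \<in> E. x \<in> d} = insert e {d \<in> E - {e}. x \<in> d}" using e by auto
      then show ?thesis using rest True finE by simp
    next
      case False
      then have "{d \<in> E. x \<in> d} = {d \<in> E - {e}. x \<in> d}" by auto
      then show ?thesis using rest False by simp
    qed
  qed
  then have "fractional_factor_indicator V E k ?h"
    using h(1) by (auto simp: fractional_factor_indicator_def)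
  then show "\<exists>h. fractional_factor_indicator V E k h \<and> h e = 1" by fastforce
qed

section \<open>Binding number and independent sets\<close>

lemma binding_number_le:
  assumes "finite V" "X \<noteq> {}" "X \<subseteq> V" "neighbours_set E X \<noteq> V"
  shows "binding_number V E \<le> real (card (neighbours_set E X)) / real (card X)"
proof -
  let ?q = "\<lambda>X. real (card (neighbours_set E X)) / real (card X)"
  have "{?q X | X. X \<noteq> {} \<and> X \<subseteq> V \<and> neighbours_set E X \<noteq> V} \<subseteq> ?q ` Pow V" by auto
  then have "finite {?q X | X. X \<noteq> {} \<and> X \<subseteq> V \<and> neighbours_set E X \<noteq> V}"
    using assms(1) by (meson finite_Pow_iff finite_imageI finite_subset)
  then show ?thesis
    unfolding binding_number_def by (rule Min_le) (use assms(2-4) in blast)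
qed

lemma independent_set_disjoint_neighbours:
  assumes "independent_set V E I" "x \<in> I"
  shows "neighbours E x \<inter> I = {}"
  using assms by (auto simp: independent_set_def induced_edges_def neighbours_def)

section \<open>Integer inequalities behind the two small-degree cases\<close>

text \<open>In the next two lemmas \<open>i = |I|\<close>, \<open>s = |S|\<close>, \<open>t = |T|\<close>, and \<open>y\<close> is the number of
  vertices of \<open>T\<close> isolated in \<open>H - S\<close>.\<close>

lemma degree_bound_arith:
  fixes k n i s t h :: int
  assumes "1 \<le> h" "h < k" "n \<ge> 6 * k - 4"
    and deg: "(3 * k - 1) * (h + s + i) > (2 * k - 1) * n + 2 * k"
    and i: "(3 * k - 1) * i < k * n - 2 * k"
    and t: "t \<le> n - i - s"
  shows "k * t + 2 \<le> k * s + h * t"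
proof (rule ccontr)
  assume "\<not> ?thesis"
  moreover have "(k - h) * t \<le> (k - h) * (n - i - s)"
    using t \<open>h < k\<close> by (intro mult_left_mono) auto
  ultimately have "(2 * k - h) * s \<le> (k - h) * (n - i) + 1"
    by (simp add: algebra_simps)
  then have "(3 * k - 1) * ((2 * k - h) * s) \<le> (3 * k - 1) * ((k - h) * (n - i) + 1)"
    using assms(1,2) by (intro mult_left_mono) auto
  moreover have "(2 * k - h) * ((2 * k - 1) * n + 2 * k) + (2 * k - h)
      \<le> (2 * k - h) * ((3 * k - 1) * (h + s + i))"
    using mult_left_mono[of "(2 * k - 1) * n + 2 * k + 1" "(3 * k - 1) * (h + s + i)" "2 * k - h"]
      deg assms(1,2) by (simp add: algebra_simps)
  \<comment> \<open>Eliminating \<open>s\<close> leaves \<open>i\<close> with coefficient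
    \<open>k * (3 * k - 1)\<close>, whence the factor \<open>k\<close> here.\<close>
  moreover have "k * ((3 * k - 1) * i) \<le> k * (k * n - 2 * k)"
    using i assms(1,2) by (intro mult_left_mono) auto
  ultimately have "k * (h - 1) * n + 6 * k * k - 2 * k * h - (2 * k - h) * h * (3 * k - 1) < 3 * k - 1"
    using assms(1,2) by (simp add: algebra_simps)
  \<comment> \<open>At \<open>n = 6 * k - 4\<close> the terms in \<open>k * k\<close> and
    \<open>k * k * h\<close> cancel, apart from none in \<open>h * h\<close>, and
    \<open>(3 * k - 1) * (h * h - 1) < 4 * k * (h - 1)\<close> is left, refuted next.\<close>
  moreover have "k * (h - 1) * (6 * k - 4) \<le> k * (h - 1) * n"
    using assms(1-3) by (intro mult_left_mono) auto
  moreover have "(3 * k - 1) * (h * h - 1) \<ge> 4 * k * (h - 1)"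
  proof -
    have "4 * k * (h - 1) \<le> (3 * k - 1) * (h + 1) * (h - 1)"
    proof (intro mult_right_mono)
      have "(3 * k - 1) * 2 \<le> (3 * k - 1) * (h + 1)"
        using assms(1,2) by (intro mult_left_mono) auto
      moreover have "4 * k \<le> (3 * k - 1) * 2" using assms(1,2) by simp
      ultimately show "4 * k \<le> (3 * k - 1) * (h + 1)" by (rule order_trans[rotated])
    qed (use assms(1) in auto)
    then show ?thesis by (simp add: algebra_simps)
  qed
  ultimately show False by (simp add: algebra_simps)
qed

lemma isolated_bound_arith:
  fixes k n i s t y :: int
  assumes "k \<ge> 2" "n \<ge> 6 * k - 4" "y \<ge> 1"
    and bind: "(3 * k - 1) * (n - 1) * (n - s - i) < (k * n - 2 * k) * (n - y)"
    and i: "(3 * k - 1) * i < k * n - 2 * k"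
    and t: "t \<le> n - i - s"
  shows "k * t + 2 \<le> k * s + (t - y)"
proof (rule ccontr)
  \<comment> \<open>\<open>P / Q\<close> is the threshold for the binding number.\<close>
  define P where "P = (3 * k - 1) * (n - 1)"
  define Q where "Q = k * n - 2 * k"
  assume "\<not> ?thesis"
  moreover have "(k - 1) * t \<le> (k - 1) * (n - i - s)"
    using t assms(1) by (intro mult_left_mono) auto
  ultimately have "(2 * k - 1) * (s + i) \<le> 1 + y + (k - 1) * n + k * i"
    by (simp add: algebra_simps)
  moreover have "P \<ge> 0" using assms(1,2) by (simp add: P_def)
  ultimately have "P * ((2 * k - 1) * (s + i)) \<le> P * (1 + y + (k - 1) * n + k * i)"
    by (intro mult_left_mono)
  moreover have "(2 * k - 1) * (P * (n - s - i)) < (2 * k - 1) * (Q * (n - y))"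
    using bind assms(1) by (intro mult_strict_left_mono) (auto simp: P_def Q_def)
  moreover have "P * (k * i) \<le> k * (n - 1) * Q"
    using mult_left_mono[of "(3 * k - 1) * i" Q "k * (n - 1)"] i assms(1,2)
    by (simp add: P_def Q_def mult_ac)
  ultimately have *: "P * (k * n - 1) - Q * ((3 * k - 1) * n - k) + y * ((2 * k - 1) * Q - P) < 0"
    by (simp add: algebra_simps)
  \<comment> \<open>This is the coefficient of \<open>y\<close> in \<open>*\<close>, so
    \<open>y = 1\<close> is the worst case. At \<open>n = 6 * k - 4\<close> it equals
    \<open>(k - 2) * (12 * k * k - 12 * k) + 3 * k - 5\<close>.\<close>
  have "(2 * k - 1) * Q - P \<ge> 0"
  proof -
    have "(2 * k * k - 4 * k + 1) * (6 * k - 4) \<le> (2 * k * k - 4 * k + 1) * n"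
      using assms(1,2) mult_right_mono[of 2 k k] by (intro mult_left_mono) auto
    moreover have "(k - 2) * (12 * k * k - 12 * k) \<ge> 0"
      using assms(1) mult_right_mono[of 1 k k] by (intro mult_nonneg_nonneg) auto
    ultimately show ?thesis
      using assms(1) by (simp add: P_def Q_def algebra_simps)
  qed
  then have "1 * ((2 * k - 1) * Q - P) \<le> y * ((2 * k - 1) * Q - P)"
    using assms(3) by (intro mult_right_mono) auto
  \<comment> \<open>The factor next to \<open>Q\<close> is \<open>P\<close> itself, and
    \<open>k * n - 2\<close> exceeds \<open>Q\<close> by \<open>2 * k - 2\<close>.\<close>
  moreover have "P * (k * n - 2) - Q * ((3 * k - 1) * n - 3 * k + 1) = P * (2 * k - 2)"
    by (simp add: P_def Q_def algebra_simps)
  moreover have "P * (2 * k - 2) \<ge> 0" using \<open>P \<ge> 0\<close> assms(1) by simp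
  ultimately show False using * by (simp add: algebra_simps)
qed

section \<open>Verifying the cut criterion in G - I\<close>

theorem corollary1p3:
  fixes V :: "'a set" and E :: "'a set set" and k n :: nat
  assumes "k \<ge> 2"
    and "simple_graph V E"
    and "card V = n"
    and "n \<ge> 6 * k - 4"
    and "binding_number V E > (3 * real k - 1) * (real n - 1) / (real k * real n - 2 * real k)"
  shows "fractional_ID_factor_critical_covered V E k"
  unfolding fractional_ID_factor_critical_covered_def
proof (intro allI impI)
  fix I assume I: "independent_set V E I"
  have finV: "finite V" and E: "\<And>e. e \<in> E \<Longrightarrow> e \<subseteq> V \<and> card e = 2"
    using assms(2) by (auto simp: simple_graph_def)
  have n: "n \<ge> 8" "int n \<ge> 6 * int k - 4" using assms(1,4) by auto
  have fin: "finite A" if "A \<subseteq> V" for A using that finV finite_subset by blast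
  have nbrs: "neighbours E x \<subseteq> V" "x \<notin> neighbours E x" for x
    using E[of "{x, x}"] by (auto simp: neighbours_def dest: E)
  have nbr_sym: "y \<in> neighbours E x \<longleftrightarrow> x \<in> neighbours E y" for x y
    by (simp add: neighbours_def insert_commute)
  \<comment> \<open>The binding number hypothesis with denominators cleared, for nonempty
    \<open>X\<close> and \<open>Y\<close> with no edge between them: the neighbourhood of
    \<open>X\<close> misses \<open>Y\<close>, so it is not \<open>V\<close>.\<close>
  have bind: "(3 * int k - 1) * (int n - 1) * int (card X)
      < (int k * int n - 2 * int k) * int (n - card Y)"
    if "X \<noteq> {}" "X \<subseteq> V" "Y \<noteq> {}" "Y \<subseteq> V" "\<And>x. x \<in> X \<Longrightarrow> neighbours E x \<inter> Y = {}" for X Y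
  proof -
    have N: "neighbours_set E X \<subseteq> V - Y"
      using that(5) nbrs(1) by (fastforce simp: neighbours_set_def)
    then have "neighbours_set E X \<noteq> V" using that(3,4) by blast
    then have "(3 * real k - 1) * (real n - 1) / (real k * real n - 2 * real k)
        < real (card (neighbours_set E X)) / real (card X)"
      using binding_number_le[OF finV that(1,2)] assms(5) by force
    moreover have "real k * real n - 2 * real k > 0" "card X > 0"
      using n assms(1) fin[OF that(2)] that(1)
      by (auto simp: card_gt_0_iff simp flip: left_diff_distrib' mult.commute)
    ultimately have "(3 * real k - 1) * (real n - 1) * real (card X)
        < (real k * real n - 2 * real k) * real (card (neighbours_set E X))"
      by (simp add: divide_simps mult_ac)
    also have "\<dots> \<le> (real k * real n - 2 * real k) * real (n - card Y)"
      using card_mono[OF _ N] \<open>real k * real n - 2 * real k > 0\<close> finV fin[OF that(4)] that(4) assms(3)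
      by (intro mult_left_mono) (auto simp: card_Diff_subset)
    finally have "real_of_int ((3 * int k - 1) * (int n - 1) * int (card X))
        < real_of_int ((int k * int n - 2 * int k) * int (n - card Y))"
      by simp
    then show ?thesis by (simp only: of_int_less_iff)
  qed
  have degree: "(3 * int k - 1) * int (card (neighbours E x)) > (2 * int k - 1) * int n + 2 * int k"
    if "x \<in> V" for x
  proof -
    have le: "card (neighbours E x) \<le> n"
      using card_mono[OF finV nbrs(1)] assms(3) by simp
    \<comment> \<open>With \<open>Y = {x}\<close> the right side contains \<open>n - 1\<close>,
      which cancels against the same factor of the threshold.\<close>
    have "(3 * int k - 1) * (int n - 1) * int (card (V - neighbours E x))
        < (int k * int n - 2 * int k) * int (n - card {x})"
    proof (rule bind)
      show "V - neighbours E x \<noteq> {}" using that nbrs(2) by blast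
      show "neighbours E z \<inter> {x} = {}" if "z \<in> V - neighbours E x" for z
        using that nbr_sym by blast
    qed (use that in auto)
    then have "(int n - 1) * ((3 * int k - 1) * (int n - int (card (neighbours E x))))
        < (int n - 1) * (int k * int n - 2 * int k)"
      using le n assms(3) fin[OF nbrs(1)] nbrs(1)
      by (simp add: card_Diff_subset of_nat_diff mult_ac)
    then have "(3 * int k - 1) * (int n - int (card (neighbours E x))) < int k * int n - 2 * int k"
      using n by (simp add: mult_less_cancel_left)
    then show ?thesis by (simp add: algebra_simps)
  qed
  have I_sub: "I \<subseteq> V" using I by (simp add: independent_set_def)
  \<comment> \<open>The neighbours of a vertex of \<open>I\<close> all avoid \<open>I\<close>, so
    the degree bound limits \<open>card I\<close>.\<close>
  have card_I: "(3 * int k - 1) * int (card I) < int k * int n - 2 * int k"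
  proof (cases "I = {}")
    case True
    then show ?thesis using n assms(1) by (simp flip: left_diff_distrib' mult.commute)
  next
    case False
    then obtain x where x: "x \<in> I" by blast
    have "neighbours E x \<subseteq> V - I"
      using nbrs(1) independent_set_disjoint_neighbours[OF I x] by blast
    then have "card (neighbours E x) \<le> card (V - I)"
      using finV by (intro card_mono) auto
    then have "int (card (neighbours E x)) \<le> int n - int (card I)"
      using I_sub fin assms(3) card_mono[OF finV I_sub] by (simp add: card_Diff_subset of_nat_diff)
    then have "(3 * int k - 1) * int (card (neighbours E x)) \<le> (3 * int k - 1) * (int n - int (card I))"
      using assms(1) by (intro mult_left_mono) auto
    then show ?thesis using degree[of x] x I_sub by (auto simp: algebra_simps)
  qed
  define W where "W = V - I"
  have W: "W \<subseteq> V" by (auto simp: W_def)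
  show "fractional_covered (V - I) (induced_edges E (V - I)) k"
    unfolding W_def[symmetric]
  proof (rule fractional_coveredI)
    show "simple_graph W (induced_edges E W)"
      using E fin[OF W] by (auto simp: simple_graph_def induced_edges_def)
    fix S T assume ST: "S \<subseteq> W" "T \<subseteq> W" "S \<inter> T = {}"
    define d where "d x = card (neighbours E x \<inter> (W - S))" for x
    have finS: "finite S" and finT: "finite T" using ST W fin by auto
    have "{(x, y). x \<in> T \<and> y \<in> W - S \<and> {x, y} \<in> induced_edges E W}
        = Sigma T (\<lambda>x. neighbours E x \<inter> (W - S))"
      using ST by (auto simp: induced_edges_def neighbours_def)
    then have e_T: "card {(x, y). x \<in> T \<and> y \<in> W - S \<and> {x, y} \<in> induced_edges E W} = sum d T"
      using finT fin[OF W] by (simp add: d_def)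
    have "k * card T + min 2 (card S) \<le> k * card S + sum d T"
    proof (cases "\<forall>x\<in>T. k \<le> d x")
      case True
      then have "k * card T \<le> sum d T"
        using sum_bounded_below[of T k d] by (simp add: mult.commute)
      moreover have "1 * card S \<le> k * card S" using assms(1) by (intro mult_right_mono) auto
      ultimately show ?thesis by linarith
    next
      case False
      then have "T \<noteq> {}" by auto
      then obtain x where x: "x \<in> T" and x_min: "\<And>z. z \<in> T \<Longrightarrow> d x \<le> d z"
        using ex_min_if_finite[of "d ` T"] finT
        by (metis (no_types, opaque_lifting) arg_min_least arg_min_if_finite(1))
      have "d x < k" using False x_min by (meson le_trans not_le)
      have "card (S \<union> T \<union> I) \<le> card V"
        using ST W I_sub finV by (intro card_mono) auto
      moreover have "card (S \<union> T \<union> I) = card S + card T + card I"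
        using ST finS finT fin[OF I_sub] unfolding W_def
        by (subst card_Un_disjoint; force simp: card_Un_disjoint)+
      ultimately have card_T: "int (card T) \<le> int n - int (card I) - int (card S)"
        using assms(3) by linarith
      \<comment> \<open>The bound is proved with 2 in place of the smaller
        \<open>min 2 (card S)\<close>, and over the integers, where subtraction is exact.\<close>
      have "int k * int (card T) + 2 \<le> int k * int (card S) + int (sum d T)"
      proof (cases "d x = 0")
        case True
        define Y where "Y = {z \<in> T. d z = 0}"
        have Y: "Y \<subseteq> T" "x \<in> Y" using True x by (auto simp: Y_def)
        \<comment> \<open>Each vertex of \<open>T\<close> outside \<open>Y\<close> has degree at
          least 1 in H - S, so the degree sum is at least \<open>card T - card Y\<close>.\<close>
        have "(\<Sum>z\<in>T - Y. 1) \<le> sum d (T - Y)"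
          by (intro sum_mono) (auto simp: Y_def)
        also have "\<dots> \<le> sum d T" using finT by (intro sum_mono2) auto
        finally have "card (T - Y) \<le> sum d T" by simp
        then have "card T \<le> sum d T + card Y"
          using Y finite_subset[OF Y(1) finT] by (simp add: card_Diff_subset)
        moreover have "int k * int (card T) + 2 \<le> int k * int (card S) + (int (card T) - int (card Y))"
        proof (rule isolated_bound_arith)
          have Y_nbr: "neighbours E z \<inter> (W - S) = {}" if "z \<in> Y" for z
            using that fin[OF W] by (simp add: Y_def d_def)
          have "(3 * int k - 1) * (int n - 1) * int (card (W - S))
              < (int k * int n - 2 * int k) * int (n - card Y)"
          proof (rule bind)
            \<comment> \<open>The vertex \<open>x\<close> lies in \<open>Y\<close> and, as
              \<open>S\<close> and \<open>T\<close> are disjoint, also in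
              \<open>W - S\<close>.\<close>
            show "W - S \<noteq> {}" "Y \<noteq> {}" "Y \<subseteq> V" "W - S \<subseteq> V" using Y ST W by auto
            show "neighbours E z \<inter> Y = {}" if "z \<in> W - S" for z
              using Y_nbr nbr_sym that by blast
          qed
          moreover have "card Y \<le> n" using Y ST W assms(3) finV by (metis card_mono subset_trans)
          moreover have "int (card (W - S)) = int n - int (card S) - int (card I)"
          proof -
            have "W - S = V - (S \<union> I)" by (auto simp: W_def)
            moreover have "card (S \<union> I) = card S + card I"
              using ST finS fin[OF I_sub] by (intro card_Un_disjoint) (auto simp: W_def)
            moreover have "S \<union> I \<subseteq> V" using ST W I_sub by auto
            ultimately show ?thesis
              using fin card_mono[OF finV, of "S \<union> I"] assms(3)
              by (simp add: card_Diff_subset of_nat_diff)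
          qed
          ultimately show "(3 * int k - 1) * (int n - 1) * (int n - int (card S) - int (card I))
              < (int k * int n - 2 * int k) * (int n - int (card Y))"
            by (simp add: of_nat_diff)
          have "card Y > 0" using Y finite_subset[OF Y(1) finT] by (auto simp: card_gt_0_iff)
          then show "1 \<le> int (card Y)" by simp
        qed (use assms(1) n card_I card_T in auto)
        ultimately show ?thesis by linarith
      next
        case False
        \<comment> \<open>A neighbour lost in passing from G to H - S lies in \<open>S\<close> or
          \<open>I\<close>. Hence the degree bound in G becomes a lower bound on
          \<open>d x + card S + card I\<close>.\<close>
        have "neighbours E x \<subseteq> (neighbours E x \<inter> (W - S)) \<union> S \<union> I"
          using nbrs(1) by (auto simp: W_def)
        then have "card (neighbours E x) \<le> card ((neighbours E x \<inter> (W - S)) \<union> S \<union> I)"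
          using fin[OF W] finS fin[OF I_sub] by (intro card_mono) auto
        also have "\<dots> \<le> d x + card S + card I"
          unfolding d_def by (meson add_right_mono card_Un_le order_trans)
        finally have "(3 * int k - 1) * int (card (neighbours E x))
            \<le> (3 * int k - 1) * (int (d x) + int (card S) + int (card I))"
          using assms(1) by (intro mult_left_mono) auto
        moreover have "x \<in> V" using x ST W by auto
        ultimately have "(3 * int k - 1) * (int (d x) + int (card S) + int (card I))
            > (2 * int k - 1) * int n + 2 * int k"
          using degree by fastforce
        then have "int k * int (card T) + 2 \<le> int k * int (card S) + int (d x) * int (card T)"
          using False \<open>d x < k\<close> n(2) card_I card_T by (intro degree_bound_arith) auto
        moreover have "d x * card T \<le> sum d T"
          using sum_bounded_below[of T "d x" d] x_min by (simp add: mult.commute)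
        then have "int (d x) * int (card T) \<le> int (sum d T)"
          by (metis of_nat_le_iff of_nat_mult)
        ultimately show ?thesis by linarith
      qed
      then have "int (k * card T + 2) \<le> int (k * card S + sum d T)" by simp
      then have "k * card T + 2 \<le> k * card S + sum d T" by (simp only: of_nat_le_iff)
      then show ?thesis by linarith
    qed
    then show "k * card T + min 2 (card S) \<le> k * card S +
        card {(x, y). x \<in> T \<and> y \<in> W - S \<and> {x, y} \<in> induced_edges E W}"
      unfolding e_T .
  qed
qed

end
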